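(* The isomorphism types realized by $\Pi^0_1$ equivalence structures coincide with those realized by $\Delta^0_2$ equivalence structures: $\operatorname{IsoType}(\mathbb{EQ}, \Pi^0_1) = \operatorname{IsoType}(\mathbb{EQ}, \Delta^0_2)$. In other words, every $\Delta^0_2$ equivalence structure is isomorphic to a $\Pi^0_1$ equivalence structure (and conversely every $\Pi^0_1$ one is trivially $\Delta^0_2$).
   Context: An equivalence structure is a structure $\langle \omega, R\rangle$ where $R\subseteq\omega^2$ is an equivalence relation on $\omega$ (the domain is always $\omega$). For a complexity class $\Gamma$, the structure $\langle\omega,R\rangle$ is called a $\Gamma$ equivalence structure if the relation $R$, viewed as a subset of $\omega^2$, belongs to $\Gamma$. $\mathbb{EQ}$ denotes the class of countable equivalence structures, and $\operatorname{IsoType}(\mathbb{EQ},\Gamma)$ denotes the collection of isomorphism types realized by $\Gamma$ equivalence structures. *)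

theory Defs
  imports Main
begin

text \<open>
  Total recursive functions: the least class containing the initial functions and closed under
  composition, primitive recursion and minimisation restricted to regular functions (those for
  which the search always succeeds). \<open>recursive_fun n f\<close> says that \<open>f\<close> is an \<open>n\<close>-ary recursive
  function; only its values on lists of length \<open>n\<close> are meaningful.
\<close>

inductive recursive_fun :: "nat \<Rightarrow> (nat list \<Rightarrow> nat) \<Rightarrow> bool" where
  zero: "recursive_fun n (\<lambda>xs. 0)"
| succ: "recursive_fun 1 (\<lambda>xs. Suc (xs ! 0))"
| proj: "i < n \<Longrightarrow> recursive_fun n (\<lambda>xs. xs ! i)"
| comp: "recursive_fun (length gs) f \<Longrightarrow> (\<And>g. g \<in> set gs \<Longrightarrow> recursive_fun n g) \<Longrightarrow>
    recursive_fun n (\<lambda>xs. f (map (\<lambda>g. g xs) gs))"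
| prim: "recursive_fun n f \<Longrightarrow> recursive_fun (Suc (Suc n)) g \<Longrightarrow>
    recursive_fun (Suc n)
      (\<lambda>xs. rec_nat (f (tl xs)) (\<lambda>y r. g (y # r # tl xs)) (hd xs))"
| mu: "recursive_fun (Suc n) f \<Longrightarrow> (\<And>xs. length xs = n \<Longrightarrow> \<exists>y. f (y # xs) = 0) \<Longrightarrow>
    recursive_fun n (\<lambda>xs. LEAST y. f (y # xs) = 0)"

text \<open>A \<open>k\<close>-ary relation on \<open>\<omega>\<close> is a set of lists of length \<open>k\<close>.\<close>

definition computable_rels :: "nat \<Rightarrow> nat list set set" where
  "computable_rels k = {A. A \<subseteq> {xs. length xs = k} \<and>
     (\<exists>f. recursive_fun k f \<and>
        (\<forall>xs. length xs = k \<longrightarrow> f xs = (if xs \<in> A then 1 else 0)))}"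

text \<open>
  The arithmetical hierarchy: \<open>Sigma0 n k\<close> and \<open>Pi0 n k\<close> are the \<open>k\<close>-ary relations in
  \<open>\<Sigma>\<^sup>0\<^sub>n\<close> and \<open>\<Pi>\<^sup>0\<^sub>n\<close>. The quantified variable is the first argument of the matrix.
\<close>

fun Sigma0 :: "nat \<Rightarrow> nat \<Rightarrow> nat list set set"
  and Pi0 :: "nat \<Rightarrow> nat \<Rightarrow> nat list set set" where
  "Sigma0 0 k = computable_rels k"
| "Sigma0 (Suc n) k = {{xs. length xs = k \<and> (\<exists>y. y # xs \<in> B)} | B. B \<in> Pi0 n (Suc k)}"
| "Pi0 0 k = computable_rels k"
| "Pi0 (Suc n) k = {{xs. length xs = k \<and> (\<forall>y. y # xs \<in> B)} | B. B \<in> Sigma0 n (Suc k)}"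

definition Delta0 :: "nat \<Rightarrow> nat \<Rightarrow> nat list set set" where
  "Delta0 n k = Sigma0 n k \<inter> Pi0 n k"

text \<open>
  A structure \<open>\<langle>\<omega>, R\<rangle>\<close> is identified with \<open>R\<close>. For a class \<open>\<Gamma>\<close> of relations, indexed by arity,
  \<open>structs \<Gamma>\<close> are the structures whose binary relation belongs to \<open>\<Gamma>\<close>.
\<close>

definition structs :: "(nat \<Rightarrow> nat list set set) \<Rightarrow> nat rel set" where
  "structs \<Gamma> = {R. {[x, y] | x y. (x, y) \<in> R} \<in> \<Gamma> 2}"

definition EQ :: "nat rel set" where
  "EQ = {R. equiv UNIV R}"

definition isomorphic :: "nat rel \<Rightarrow> nat rel \<Rightarrow> bool" where
  "isomorphic R S \<longleftrightarrow> (\<exists>f. bij f \<and> (\<forall>x y. (x, y) \<in> R \<longleftrightarrow> (f x, f y) \<in> S))"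

definition iso_type :: "nat rel \<Rightarrow> nat rel set" where
  "iso_type R = {S. isomorphic R S}"

definition IsoType :: "nat rel set \<Rightarrow> (nat \<Rightarrow> nat list set set) \<Rightarrow> nat rel set set" where
  "IsoType K \<Gamma> = iso_type ` (K \<inter> structs \<Gamma>)"

end

(*
  A Delta^0_2 relation is the limit of a computable sequence of guesses. Suppose R has infinitely many
  classes. In a Pi^0_1 equivalence relation blocks may split as the stages proceed but not merge; only
  fresh elements may join a block. The copy of R consists of bases, which are pairwise inequivalent and
  stand for the minima of the R-classes in increasing order, and of elements attached to a base, which
  stand for the other elements of R. When the guess behind an attachment changes, the attached element
  is cut off and becomes one more base. This shifts the enumeration of the bases, but since the set of
  bases only grows, the i-th base changes finitely often. As R has infinitely many classes, no base
  is superfluous, and every element settles. If R has finitely many classes, it has a computable copy.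
*)
theory Submission
  imports Defs Complex_Main "HOL-Library.Infinite_Set"
begin

subsection \<open>Closure properties of the recursive functions\<close>

text \<open>
  Values of a recursive function on lists of the wrong length are junk, hence \<open>computable\<close> is stated up to
  agreement on lists of length \<open>n\<close>. A list \<open>e\<close> plays the role of an environment: in the closure
  rules below, the body of a binder sees the bound variable as \<open>hd e\<close> and the outer environment
  as \<open>tl e\<close>.
\<close>

definition computable :: "nat \<Rightarrow> (nat list \<Rightarrow> nat) \<Rightarrow> bool" where
  "computable n f \<longleftrightarrow> (\<exists>g. recursive_fun n g \<and> (\<forall>e. length e = n \<longrightarrow> g e = f e))"

definition decidable :: "nat \<Rightarrow> (nat list \<Rightarrow> bool) \<Rightarrow> bool" where
  "decidable n P \<longleftrightarrow> computable n (\<lambda>e. of_bool (P e))"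

lemma computable_cong: "computable n f \<Longrightarrow> (\<And>e. length e = n \<Longrightarrow> f e = f' e) \<Longrightarrow> computable n f'"
  unfolding computable_def by metis

lemma decidable_cong: "decidable n P \<Longrightarrow> (\<And>e. length e = n \<Longrightarrow> P e = P' e) \<Longrightarrow> decidable n P'"
  unfolding decidable_def by (erule computable_cong) simp

lemma computable_compose:
  assumes "computable (length gs) f" and "\<And>g. g \<in> set gs \<Longrightarrow> computable n g"
  shows "computable n (\<lambda>e. f (map (\<lambda>g. g e) gs))"
proof -
  obtain f' where f': "recursive_fun (length gs) f'" "\<And>e. length e = length gs \<Longrightarrow> f' e = f e"
    using assms(1) unfolding computable_def by blast
  obtain G where G: "\<And>g. g \<in> set gs \<Longrightarrow> recursive_fun n (G g)"
    "\<And>g e. g \<in> set gs \<Longrightarrow> length e = n \<Longrightarrow> G g e = g e"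
    using assms(2) unfolding computable_def by metis
  have "recursive_fun n (\<lambda>e. f' (map (\<lambda>g. g e) (map G gs)))"
    by (rule recursive_fun.comp) (use f' G in auto)
  moreover have "f' (map (\<lambda>g. g e) (map G gs)) = f (map (\<lambda>g. g e) gs)" if "length e = n" for e
  proof -
    have "map (\<lambda>g. g e) (map G gs) = map (\<lambda>g. g e) gs"
      using G(2) that by simp
    then show ?thesis using f'(2)[of "map (\<lambda>g. g e) (map G gs)"] by (simp del: map_map)
  qed
  ultimately show ?thesis unfolding computable_def by blast
qed

lemma computable_nth: "i < n \<Longrightarrow> computable n (\<lambda>e. e ! i)"
  unfolding computable_def using recursive_fun.proj by blast

lemma computable_comp1: "computable 1 (\<lambda>e. f (e ! 0)) \<Longrightarrow> computable n a \<Longrightarrow> computable n (\<lambda>e. f (a e))"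
  using computable_compose[of "[a]" "\<lambda>e. f (e ! 0)" n] by simp

lemma computable_comp2:
  "computable 2 (\<lambda>e. f (e ! 0) (e ! 1)) \<Longrightarrow> computable n a \<Longrightarrow> computable n b \<Longrightarrow> computable n (\<lambda>e. f (a e) (b e))"
  using computable_compose[of "[a, b]" "\<lambda>e. f (e ! 0) (e ! 1)" n] by (auto simp: numeral_2_eq_2)

lemma computable_comp3:
  "computable 3 (\<lambda>e. f (e ! 0) (e ! 1) (e ! 2)) \<Longrightarrow> computable n a \<Longrightarrow> computable n b \<Longrightarrow> computable n c \<Longrightarrow>
    computable n (\<lambda>e. f (a e) (b e) (c e))"
  using computable_compose[of "[a, b, c]" "\<lambda>e. f (e ! 0) (e ! 1) (e ! 2)" n]
  by (auto simp: numeral_2_eq_2 numeral_3_eq_3)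

lemma computable_reindex:
  assumes "computable (length ns) f" and "\<And>i. i \<in> set ns \<Longrightarrow> i < n"
  shows "computable n (\<lambda>e. f (map ((!) e) ns))"
  using computable_compose[of "map (\<lambda>i e. e ! i) ns" f n] assms computable_nth by (auto simp: comp_def)

lemma computable_env_Cons:
  assumes "computable (Suc n) f" and "computable n k"
  shows "computable n (\<lambda>e. f (k e # e))"
proof -
  have "computable n (\<lambda>e. f (map (\<lambda>g. g e) (k # map (\<lambda>i e. e ! i) [0..<n])))"
    by (rule computable_compose) (use assms computable_nth in auto)
  then show ?thesis
    by (rule computable_cong) (auto simp: comp_def map_nth)
qed

text \<open>Nested binders put an extra entry into second place, such as the accumulator of a
  bounded sum or the outer index of a search. The body has to be evaluated without it.\<close>

lemma computable_env_drop1: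
  assumes "computable (Suc n) f"
  shows "computable (Suc (Suc n)) (\<lambda>e. f (hd e # tl (tl e)))"
proof -
  have "computable (Suc (Suc n)) (\<lambda>e. f (map ((!) e) (0 # [Suc (Suc 0)..<Suc (Suc n)])))"
    by (rule computable_reindex) (use assms in \<open>auto simp del: upt_Suc\<close>)
  then show ?thesis
  proof (rule computable_cong)
    fix e :: "nat list" assume "length e = Suc (Suc n)"
    then obtain x y e' where "e = x # y # e'" "length e' = n"
      by (metis length_Suc_conv)
    then have "map ((!) e) (0 # [Suc (Suc 0)..<Suc (Suc n)]) = hd e # tl (tl e)"
      by (auto intro!: nth_equalityI simp: nth_Cons' simp del: upt_Suc)
    then show "f (map ((!) e) (0 # [Suc (Suc 0)..<Suc (Suc n)])) = f (hd e # tl (tl e))" by simp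
  qed
qed

lemma computable_env_tl:
  assumes "computable n f" shows "computable (Suc n) (\<lambda>e. f (tl e))"
proof -
  have "computable (Suc n) (\<lambda>e. f (map ((!) e) [1..<Suc n]))"
    by (rule computable_reindex) (use assms in \<open>auto simp del: upt_Suc\<close>)
  then show ?thesis
  proof (rule computable_cong)
    fix e :: "nat list" assume "length e = Suc n"
    then have "map ((!) e) [1..<Suc n] = tl e"
      by (auto intro!: nth_equalityI simp: nth_tl simp del: upt_Suc)
    then show "f (map ((!) e) [1..<Suc n]) = f (tl e)" by simp
  qed
qed

lemma computable_hd: "0 < n \<Longrightarrow> computable n (\<lambda>e. hd e)"
  by (rule computable_cong[OF computable_nth[of 0]]) (auto simp: hd_conv_nth)

lemma computable_rec_nat:
  assumes f: "computable n f" and g: "computable (Suc (Suc n)) g" and k: "computable n k"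
  shows "computable n (\<lambda>e. rec_nat (f e) (\<lambda>y r. g (y # r # e)) (k e))"
proof -
  obtain f' where f': "recursive_fun n f'" "\<And>e. length e = n \<Longrightarrow> f' e = f e"
    using f unfolding computable_def by blast
  obtain g' where g': "recursive_fun (Suc (Suc n)) g'"
    "\<And>e. length e = Suc (Suc n) \<Longrightarrow> g' e = g e"
    using g unfolding computable_def by blast
  have *: "rec_nat (f' e) (\<lambda>y r. g' (y # r # e)) m = rec_nat (f e) (\<lambda>y r. g (y # r # e)) m"
    if "length e = n" for e m
    by (induction m) (use f' g' that in auto)
  have "computable (Suc n) (\<lambda>e. rec_nat (f (tl e)) (\<lambda>y r. g (y # r # tl e)) (hd e))"
    unfolding computable_def using recursive_fun.prim[OF f'(1) g'(1)] *
    by (intro exI conjI) auto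
  from computable_env_Cons[OF this k] show ?thesis by simp
qed

text \<open>The curried form of \<open>g\<close> lets unification read off the step function from a
  concrete recursion.\<close>

lemma computable_primrec:
  assumes "computable n f" and "computable (Suc (Suc n)) (\<lambda>e. g (hd e) (hd (tl e)) (tl (tl e)))" and "computable n k"
  shows "computable n (\<lambda>e. rec_nat (f e) (\<lambda>y r. g y r e) (k e))"
  using computable_rec_nat[OF assms] by simp

lemma computable_Suc: "computable n f \<Longrightarrow> computable n (\<lambda>e. Suc (f e))"
proof (rule computable_comp1[of Suc])
  show "computable 1 (\<lambda>e. Suc (e ! 0))" unfolding computable_def using recursive_fun.succ by blast
qed

lemma computable_const: "computable n (\<lambda>e. c)"
proof (induction c)
  case 0
  show ?case unfolding computable_def using recursive_fun.zero by blast
qed (rule computable_Suc)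

lemmas computable_var = computable_hd computable_nth computable_env_tl

section \<open>Arithmetic, bounded quantifiers and bounded search\<close>

lemma computable_add: assumes "computable n a" "computable n b" shows "computable n (\<lambda>e. a e + b e)"
proof -
  have "rec_nat x (\<lambda>_ r. Suc r) y = x + y" for x y :: nat by (induction y) auto
  moreover have "computable n (\<lambda>e. rec_nat (a e) (\<lambda>_ r. Suc r) (b e))"
    by (intro computable_primrec computable_Suc computable_var assms) simp
  ultimately show ?thesis by simp
qed

lemma computable_mult: assumes "computable n a" "computable n b" shows "computable n (\<lambda>e. a e * b e)"
proof -
  have "rec_nat 0 (\<lambda>_ r. r + x) y = x * y" for x y :: nat by (induction y) auto
  moreover have "computable n (\<lambda>e. rec_nat 0 (\<lambda>_ r. r + a e) (b e))"
    by (intro computable_primrec computable_add computable_const computable_var assms computable_env_tl) simp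
  ultimately show ?thesis by simp
qed

lemma computable_power: assumes "computable n a" "computable n b" shows "computable n (\<lambda>e. a e ^ b e)"
proof -
  have "rec_nat 1 (\<lambda>_ r. r * x) y = x ^ y" for x y :: nat by (induction y) auto
  moreover have "computable n (\<lambda>e. rec_nat 1 (\<lambda>_ r. r * a e) (b e))"
    by (intro computable_primrec computable_mult computable_const computable_var assms computable_env_tl) simp
  ultimately show ?thesis by simp
qed

lemma computable_diff: assumes "computable n a" "computable n b" shows "computable n (\<lambda>e. a e - b e)"
proof -
  have pred: "rec_nat 0 (\<lambda>y _. y) x = x - 1" for x :: nat by (cases x) auto
  have pred_computable: "computable n (\<lambda>e. f e - 1)" if "computable n f" for n and f :: "nat list \<Rightarrow> nat"
    using computable_primrec[OF computable_const[of n 0] _ that, of "\<lambda>y _ _. y"] by (simp add: pred computable_var)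
  have "computable n (\<lambda>e. rec_nat (a e) (\<lambda>_ r. r - 1) (b e))"
    by (intro computable_primrec assms pred_computable computable_var) simp
  moreover have "rec_nat x (\<lambda>_ r. r - 1) y = x - y" for x y :: nat by (induction y) auto
  ultimately show ?thesis by simp
qed

lemma computable_sum:
  assumes "computable n k" and "computable (Suc n) (\<lambda>e. f (hd e) (tl e))"
  shows "computable n (\<lambda>e. \<Sum>i<k e. f i e)"
proof -
  have "rec_nat 0 (\<lambda>y r. r + f y e) m = (\<Sum>i<m. f i e)" for m e by (induction m) auto
  moreover have "computable n (\<lambda>e. rec_nat 0 (\<lambda>y r. r + f y e) (k e))"
    by (intro computable_primrec computable_add computable_const computable_var assms)
      (use computable_env_drop1[OF assms(2)] in simp_all)
  ultimately show ?thesis by simp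
qed

lemma computable_of_bool: "decidable n P \<Longrightarrow> computable n (\<lambda>e. of_bool (P e))"
  unfolding decidable_def .

lemma decidable_eq: assumes "computable n a" "computable n b" shows "decidable n (\<lambda>e. a e = b e)"
proof -
  have "computable n (\<lambda>e. 1 - ((a e - b e) + (b e - a e)))" by (intro computable_diff computable_add computable_const assms)
  then show ?thesis unfolding decidable_def by (rule computable_cong) auto
qed

lemma decidable_le: assumes "computable n a" "computable n b" shows "decidable n (\<lambda>e. a e \<le> b e)"
proof -
  have "computable n (\<lambda>e. 1 - (a e - b e))" by (intro computable_diff computable_const assms)
  then show ?thesis unfolding decidable_def by (rule computable_cong) auto
qed

lemma decidable_less: assumes "computable n a" "computable n b" shows "decidable n (\<lambda>e. a e < b e)"
  using decidable_le[OF computable_Suc[OF assms(1)] assms(2)] by (simp add: Suc_le_eq)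

lemma decidable_not: assumes "decidable n P" shows "decidable n (\<lambda>e. \<not> P e)"
proof -
  have "computable n (\<lambda>e. 1 - of_bool (P e))" by (intro computable_diff computable_const computable_of_bool assms)
  then show ?thesis unfolding decidable_def by (rule computable_cong) auto
qed

lemma decidable_conj: assumes "decidable n P" "decidable n Q" shows "decidable n (\<lambda>e. P e \<and> Q e)"
proof -
  have "computable n (\<lambda>e. of_bool (P e) * of_bool (Q e))" by (intro computable_mult computable_of_bool assms)
  then show ?thesis unfolding decidable_def by (rule computable_cong) auto
qed

lemma decidable_disj: assumes "decidable n P" "decidable n Q" shows "decidable n (\<lambda>e. P e \<or> Q e)"
  using decidable_not[OF decidable_conj[OF decidable_not[OF assms(1)] decidable_not[OF assms(2)]]] by simp

lemma decidable_imp: assumes "decidable n P" "decidable n Q" shows "decidable n (\<lambda>e. P e \<longrightarrow> Q e)"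
  using decidable_disj[OF decidable_not[OF assms(1)] assms(2)] by (simp only: imp_conv_disj)

lemma computable_if: assumes "decidable n P" "computable n a" "computable n b" shows "computable n (\<lambda>e. if P e then a e else b e)"
proof -
  have "computable n (\<lambda>e. of_bool (P e) * a e + of_bool (\<not> P e) * b e)"
    by (intro computable_mult computable_add computable_of_bool decidable_not assms)
  then show ?thesis by (rule computable_cong) auto
qed

text \<open>A bounded count is a bounded sum of truth values. Bounded quantifiers, bounded search,
  division and the rank of a base all reduce to such counts.\<close>

lemma computable_card:
  assumes "computable n k" and "decidable (Suc n) (\<lambda>e. P (hd e) (tl e))"
  shows "computable n (\<lambda>e. card {i. i < k e \<and> P i e})"
proof -
  have "computable n (\<lambda>e. \<Sum>i<k e. of_bool (P i e))" by (intro computable_sum computable_of_bool assms)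
  moreover have "(\<Sum>i<k e. of_bool (P i e)) = card {i. i < k e \<and> P i e}" for e
    by (simp add: of_bool_def sum.If_cases Int_def)
  ultimately show ?thesis by simp
qed

lemma decidable_ex:
  assumes "computable n k" and "decidable (Suc n) (\<lambda>e. P (hd e) (tl e))"
  shows "decidable n (\<lambda>e. \<exists>i<k e. P i e)"
proof -
  have "decidable n (\<lambda>e. 0 < card {i. i < k e \<and> P i e})" by (intro decidable_less computable_const computable_card assms)
  moreover have "0 < card {i. i < k e \<and> P i e} \<longleftrightarrow> (\<exists>i<k e. P i e)" for e
    by (auto simp: card_gt_0_iff)
  ultimately show ?thesis by simp
qed

lemma decidable_all:
  assumes "computable n k" and "decidable (Suc n) (\<lambda>e. P (hd e) (tl e))"
  shows "decidable n (\<lambda>e. \<forall>i<k e. P i e)"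
  using decidable_not[OF decidable_ex[OF assms(1) decidable_not[OF assms(2)]]] by simp

text \<open>As \<open>k e\<close> is a solution, the search is bounded, and its result is the number
  of those \<open>i\<close> for which no \<open>j \<le> i\<close> is a solution.\<close>

lemma computable_Least:
  assumes "computable n k" and "decidable (Suc n) (\<lambda>e. P (hd e) (tl e))" and "\<And>e. P (k e) e"
  shows "computable n (\<lambda>e. LEAST i. P i e)"
proof -
  have "computable n (\<lambda>e. card {i. i < k e \<and> (\<forall>j<Suc i. \<not> P j e)})"
    by (intro computable_card decidable_all decidable_not computable_Suc computable_var assms(1))
      (use computable_env_drop1[OF assms(2)[unfolded decidable_def]] in \<open>simp_all add: decidable_def\<close>)
  moreover have "{i. i < k e \<and> (\<forall>j<Suc i. \<not> P j e)} = {..<LEAST i. P i e}" for e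
  proof -
    have "(\<forall>j<Suc i. \<not> P j e) \<longleftrightarrow> i < (LEAST i. P i e)" for i
      by (metis (mono_tags, lifting) LeastI_ex assms(3) less_Suc_eq_le less_le_trans linorder_not_less not_less_Least)
    moreover have "(LEAST i. P i e) \<le> k e" using assms(3) by (rule Least_le)
    ultimately show ?thesis by auto
  qed
  ultimately show ?thesis by simp
qed

lemma computable_Least_disj:
  assumes "computable n k" and "decidable (Suc n) (\<lambda>e. P (hd e) (tl e))"
  shows "computable n (\<lambda>e. LEAST i. i = k e \<or> P i e)"
  by (rule computable_Least[OF assms(1)]) (intro decidable_disj decidable_eq computable_var assms(2) computable_env_tl[OF assms(1)] | simp)+

lemma computable_div: assumes "computable n a" "computable n b" shows "computable n (\<lambda>e. a e div b e)"
proof -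
  \<comment> \<open>The quotient counts the positive multiples of \<open>b e\<close> up to
    \<open>a e\<close>; the conjunct \<open>0 < b e\<close> produces the value 0 for division by
    zero.\<close>
  have "computable n (\<lambda>e. card {i. i < a e \<and> 0 < b e \<and> Suc i * b e \<le> a e})"
    by (intro computable_card decidable_conj decidable_le decidable_less computable_mult computable_Suc computable_const computable_var computable_env_tl assms) simp
  moreover have "{i. i < x \<and> 0 < y \<and> Suc i * y \<le> x} = {..<x div y}" for x y :: nat
  proof (cases "y = 0")
    case False
    have "i < x \<and> Suc i * y \<le> x \<longleftrightarrow> i < x div y" for i
      using False by (metis Suc_le_eq div_le_dividend le_trans less_eq_div_iff_mult_less_eq neq0_conv)
    then show ?thesis using False by auto
  qed simp
  ultimately show ?thesis by simp
qed

lemma computable_mod: assumes "computable n a" "computable n b" shows "computable n (\<lambda>e. a e mod b e)"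
  using computable_diff[OF assms(1) computable_mult[OF computable_div[OF assms] assms(2)]]
  by (simp add: minus_div_mult_eq_mod)

text \<open>Variables seen from under nested binders: each binder crossed costs one
  \<open>tl\<close>.\<close>

lemmas computable_tl_vars =
  computable_hd[THEN computable_env_tl] computable_hd[THEN computable_env_tl, THEN computable_env_tl]
  computable_hd[THEN computable_env_tl, THEN computable_env_tl, THEN computable_env_tl]
  computable_hd[THEN computable_env_tl, THEN computable_env_tl, THEN computable_env_tl, THEN computable_env_tl]
  computable_nth[THEN computable_env_tl] computable_nth[THEN computable_env_tl, THEN computable_env_tl]
  computable_nth[THEN computable_env_tl, THEN computable_env_tl, THEN computable_env_tl]
  computable_nth[THEN computable_env_tl, THEN computable_env_tl, THEN computable_env_tl, THEN computable_env_tl]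
  computable_nth[THEN computable_env_tl, THEN computable_env_tl, THEN computable_env_tl, THEN computable_env_tl, THEN computable_env_tl]

lemmas computable_intros = computable_hd computable_nth computable_tl_vars computable_const computable_Suc computable_add computable_diff computable_mult computable_power computable_div computable_mod computable_sum
  computable_of_bool computable_if computable_card computable_Least_disj decidable_eq decidable_le decidable_less decidable_not decidable_conj decidable_disj decidable_imp decidable_ex decidable_all

subsection \<open>The stage construction\<close>

text \<open>
  Element \<open>b\<close> may only ever copy the element \<open>p b\<close> of the given structure. A state \<open>d\<close> maps the elements
  present so far to bases: \<open>d b = b\<close> says that \<open>b\<close> is a base, otherwise \<open>b\<close> is attached to the base
  \<open>d b < b\<close>. The label \<open>h x\<close> is \<open>0\<close> if \<open>x\<close> is guessed to be the minimum of its class, and \<open>Suc i\<close>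
  if \<open>x\<close> is guessed to belong to the class of the \<open>i\<close>-th minimum; the \<open>i\<close>-th base copies that
  minimum. Stage \<open>s\<close> makes every attached element whose attachment has become wrong a base, for ever,
  and then places the new element \<open>s\<close>.
\<close>

definition rank :: "(nat \<Rightarrow> nat) \<Rightarrow> nat \<Rightarrow> nat" where
  "rank d a = card {i. i < a \<and> d i = i}"

definition valid :: "(nat \<Rightarrow> nat) \<Rightarrow> (nat \<Rightarrow> nat) \<Rightarrow> (nat \<Rightarrow> nat) \<Rightarrow> nat \<Rightarrow> nat \<Rightarrow> bool" where
  "valid p h d b a \<longleftrightarrow> a < b \<and> d a = a \<and> h (p b) = Suc (rank d a)"

text \<open>If \<open>p b\<close> already has an attached copy, the new element \<open>b\<close>
  becomes a base at once, so attached elements never copy the same element twice. At most one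
  \<open>a\<close> is valid, because bases have distinct ranks; \<open>LEAST\<close> merely selects
  it, with \<open>b\<close> as the default.\<close>

definition attach_step :: "(nat \<Rightarrow> nat) \<Rightarrow> (nat \<Rightarrow> nat) \<Rightarrow> (nat \<Rightarrow> nat) \<Rightarrow> nat \<Rightarrow> nat \<Rightarrow> nat" where
  "attach_step p h d s b =
    (if b < s then if valid p h d b (d b) then d b else b
     else if \<exists>i<b. p i = p b \<and> d i \<noteq> i then b
     else LEAST a. a = b \<or> valid p h d b a)"

primrec attach :: "(nat \<Rightarrow> nat) \<Rightarrow> (nat \<Rightarrow> nat \<Rightarrow> nat) \<Rightarrow> nat \<Rightarrow> nat \<Rightarrow> nat" where
  "attach p G 0 = (\<lambda>b. b)"
| "attach p G (Suc s) = (\<lambda>b. if b \<le> s then attach_step p (G s) (attach p G s) s b else b)"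

section \<open>Positions in an infinite set of natural numbers\<close>

lemma card_below_strict_mono:
  fixes m m' :: nat
  assumes "P m" "m < m'"
  shows "card {i. i < m \<and> P i} < card {i. i < m' \<and> P i}"
proof (rule psubset_card_mono)
  have "m \<in> {i. i < m' \<and> P i} - {i. i < m \<and> P i}" using assms by simp
  moreover have "{i. i < m \<and> P i} \<subseteq> {i. i < m' \<and> P i}" using assms(2) by auto
  ultimately show "{i. i < m \<and> P i} \<subset> {i. i < m' \<and> P i}" by blast
qed simp

lemma bij_betw_card_below:
  fixes M :: "nat set"
  assumes "infinite M"
  shows "bij_betw (\<lambda>m. card {i. i < m \<and> i \<in> M}) M UNIV"
proof -
  let ?r = "\<lambda>m. card {i. i < m \<and> i \<in> M}"
  have mono: "?r m < ?r m'" if "m \<in> M" "m < m'" for m m'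
    using that by (rule card_below_strict_mono)
  have inj: "inj_on ?r M"
  proof (rule inj_onI)
    fix m m' assume "m \<in> M" "m' \<in> M" "?r m = ?r m'"
    then show "m = m'" using mono[of m m'] mono[of m' m] by (cases m m' rule: linorder_cases) auto
  qed
  have "n \<in> ?r ` M" for n
  proof (induction n)
    case 0
    obtain m0 where "m0 \<in> M" using assms by (metis ex_in_conv finite.emptyI)
    define l where "l = (LEAST m. m \<in> M)"
    have "l \<in> M" unfolding l_def using \<open>m0 \<in> M\<close> by (rule LeastI)
    moreover have "{i. i < l \<and> i \<in> M} = {}"
      by (auto simp: l_def dest: not_less_Least)
    then have "0 = ?r l" by (simp only: card.empty)
    ultimately show ?case by (rule rev_image_eqI)
  next
    case (Suc n)
    then obtain m where m: "m \<in> M" "n = ?r m" by blast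
    obtain k where k: "k \<in> M" "m < k" using assms by (meson infinite_nat_iff_unbounded)
    \<comment> \<open>The next element of \<open>M\<close> after \<open>m\<close> has exactly one
      more predecessor in \<open>M\<close>.\<close>
    define m' where "m' = (LEAST k. k \<in> M \<and> m < k)"
    have m': "m' \<in> M" "m < m'" unfolding m'_def using k LeastI[of "\<lambda>k. k \<in> M \<and> m < k" k] by auto
    have "i < m' \<and> i \<in> M \<longleftrightarrow> i = m \<or> i < m \<and> i \<in> M" for i
    proof -
      have "\<not> (i \<in> M \<and> m < i)" if "i < m'"
        using that unfolding m'_def by (rule not_less_Least)
      then show ?thesis using m m' by (cases i m rule: linorder_cases) auto
    qed
    then have "{i. i < m' \<and> i \<in> M} = insert m {i. i < m \<and> i \<in> M}" by auto
    then have "Suc n = ?r m'" using m by simp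
    with m'(1) show ?case by (rule rev_image_eqI)
  qed
  then show ?thesis using inj by (auto simp: bij_betw_def)
qed

text \<open>\<open>p\<close> offers every element infinitely many candidates to copy it.
  \<open>G s\<close> holds the labels guessed at stage \<open>s\<close>, which are correct only in
  the limit \<open>g\<close>.\<close>

locale limit_labelling =
  fixes p :: "nat \<Rightarrow> nat" and G :: "nat \<Rightarrow> nat \<Rightarrow> nat" and g :: "nat \<Rightarrow> nat"
  assumes infinite_fibre: "infinite {b. p b = x}"
    and G_limit: "\<forall>\<^sub>F s in sequentially. G s x = g x"
begin

abbreviation att :: "nat \<Rightarrow> nat \<Rightarrow> nat" where
  "att \<equiv> attach p G"

text \<open>An entry changes at most once after its placement, and then to \<open>b\<close> for
  ever, so the limit has a direct description. Stages up to \<open>b\<close> are excluded because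
  there \<open>att s b = b\<close> by default.\<close>

definition lim_att :: "nat \<Rightarrow> nat" where
  "lim_att b = (if \<exists>s>b. att s b = b then b else att (Suc b) b)"

lemma att_ge: "s \<le> b \<Longrightarrow> att s b = b"
  by (cases s) auto

lemma att_Suc_valid:
  assumes "att (Suc s) b \<noteq> b"
  shows "valid p (G s) (att s) b (att (Suc s) b)"
proof -
  have bs: "b \<le> s" using assms att_ge not_less_eq_eq by blast
  show ?thesis
  proof (cases "b < s")
    case True
    then show ?thesis using assms bs by (auto simp: attach_step_def split: if_splits)
  next
    case False
    then have "att (Suc s) b = (LEAST a. a = b \<or> valid p (G s) (att s) b a)"
      using assms bs by (auto simp: attach_step_def split: if_splits)
    moreover have "(LEAST a. a = b \<or> valid p (G s) (att s) b a) = b \<or>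
        valid p (G s) (att s) b (LEAST a. a = b \<or> valid p (G s) (att s) b a)"
      by (rule LeastI[of _ b]) simp
    ultimately show ?thesis using assms by metis
  qed
qed

lemma att_mono_cases:
  assumes "b < s" "s \<le> t"
  shows "att t b = att s b \<or> att t b = b"
  using \<open>s \<le> t\<close>
proof (induction t rule: dec_induct)
  case (step t)
  then have "b < t" using assms by simp
  then have "att (Suc t) b = att t b \<or> att (Suc t) b = b" by (simp add: attach_step_def)
  then show ?case using step.IH by metis
qed simp

lemma att_base_stays: "att s b = b \<Longrightarrow> b < s \<Longrightarrow> s \<le> t \<Longrightarrow> att t b = b"
  using att_mono_cases by metis

lemma att_less: "att s b \<noteq> b \<Longrightarrow> att s b < b"
  using att_Suc_valid[of "s - 1" b] by (cases s) (auto simp: valid_def)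

lemma att_neq_imp_less: "att s b \<noteq> b \<Longrightarrow> b < s"
  using att_ge not_less by blast

text \<open>Validity asks the target to be a base before the stage; it is still one afterwards
  because bases are permanent.\<close>

lemma att_att: "att s (att s b) = att s b"
proof (cases "att s b = b")
  case False
  then have "b < s" by (rule att_neq_imp_less)
  then obtain s' where s: "s = Suc s'" by (cases s) auto
  have "valid p (G s') (att s') b (att s b)" using att_Suc_valid False s by blast
  then have *: "att s b < b" "att s' (att s b) = att s b" by (auto simp: valid_def)
  then have "att s b < s'" using \<open>b < s\<close> s by simp
  from att_base_stays[OF *(2) this, of s] s show ?thesis by simp
qed simp

lemma lim_att_cases: "b < s \<Longrightarrow> lim_att b = att s b \<or> lim_att b = b"
  unfolding lim_att_def using att_mono_cases[of b "Suc b" s] by auto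

lemma att_limit: "\<forall>\<^sub>F s in sequentially. att s b = lim_att b"
proof (cases "\<exists>s>b. att s b = b")
  case True
  then obtain s where "b < s" "att s b = b" by blast
  then show ?thesis unfolding eventually_sequentially lim_att_def
    using att_base_stays by (metis True)
next
  case False
  then show ?thesis unfolding eventually_sequentially lim_att_def
    using att_mono_cases[of b "Suc b"] by (metis Suc_le_eq lessI)
qed

lemma lim_att_neq: "lim_att b \<noteq> b \<Longrightarrow> b < s \<Longrightarrow> att s b = lim_att b"
  using lim_att_cases by metis

lemma lim_att_eq_base: "att s b = b \<Longrightarrow> b < s \<Longrightarrow> lim_att b = b"
  using lim_att_cases by metis

lemma lim_att_idem: "lim_att (lim_att b) = lim_att b"
proof (cases "lim_att b = b")
  case False
  have "att (Suc b) b = lim_att b" by (rule lim_att_neq[OF False lessI])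
  moreover have "lim_att b < b" using calculation False att_less by metis
  ultimately show ?thesis using att_att lim_att_eq_base by (metis less_Suc_eq)
qed simp

text \<open>This is the \<Pi>-form of the copy: blocks split but never merge. If \<open>b\<close> is
  finally a base to which \<open>b'\<close> is attached, then \<open>b'\<close> was attached to
  \<open>b\<close> at every earlier stage too, and by \<open>att_att\<close> that makes
  \<open>b\<close> a base then.\<close>

lemma lim_att_eq_iff:
  "lim_att b = lim_att b' \<longleftrightarrow> (\<forall>s. b < s \<and> b' < s \<longrightarrow> att s b = att s b')"
proof
  assume "\<forall>s. b < s \<and> b' < s \<longrightarrow> att s b = att s b'"
  then have "\<forall>\<^sub>F s in sequentially. att s b = att s b'"
    unfolding eventually_sequentially by (metis Suc_le_eq max.bounded_iff)
  then have "\<forall>\<^sub>F s in sequentially. lim_att b = lim_att b'"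
    using att_limit[of b] att_limit[of b'] by eventually_elim simp
  then show "lim_att b = lim_att b'" by simp
next
  assume eq: "lim_att b = lim_att b'"
  show "\<forall>s. b < s \<and> b' < s \<longrightarrow> att s b = att s b'"
  proof (intro allI impI, elim conjE)
    fix s assume s: "b < s" "b' < s"
    show "att s b = att s b'"
      using lim_att_cases[OF s(1)] lim_att_cases[OF s(2)] eq att_att by metis
  qed
qed

lemma rank_limit: "\<forall>\<^sub>F s in sequentially. rank (att s) a = rank lim_att a"
proof -
  have "\<forall>\<^sub>F s in sequentially. \<forall>i\<in>{..<a}. att s i = lim_att i"
    by (rule eventually_ball_finite) (use att_limit in auto)
  then show ?thesis
  proof eventually_elim
    case (elim s)
    then have "{i. i < a \<and> att s i = i} = {i. i < a \<and> lim_att i = i}" by auto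
    then show ?case by (simp add: rank_def)
  qed
qed

text \<open>An attachment that survives for ever passes the check at every stage, in particular
  after the label and the rank have reached their limits.\<close>

lemma lim_att_label:
  assumes "lim_att b \<noteq> b"
  shows "g (p b) = Suc (rank lim_att (lim_att b))"
proof -
  have "\<forall>\<^sub>F s in sequentially. g (p b) = Suc (rank lim_att (lim_att b))"
    using G_limit[of "p b"] rank_limit[of "lim_att b"] eventually_ge_at_top[of b]
  proof eventually_elim
    case (elim s)
    then have "att (Suc s) b = lim_att b" by (intro lim_att_neq[OF assms]) simp
    then show ?case using att_Suc_valid[of s b] assms elim by (simp add: valid_def)
  qed
  then show ?thesis by simp
qed

text \<open>Of two candidates for the same element, the later one finds the earlier one attached
  when it is placed, and so becomes a base.\<close>

lemma attached_unique:
  assumes "lim_att b \<noteq> b" "lim_att b' \<noteq> b'" "p b = p b'"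
  shows "b = b'"
proof -
  have *: False if "lim_att i \<noteq> i" "lim_att j \<noteq> j" "p i = p j" "i < j" for i j
  proof -
    have "att (Suc j) j \<noteq> j" using lim_att_eq_base that by blast
    moreover have "att j i \<noteq> i" using lim_att_eq_base that by blast
    ultimately show False using that by (auto simp: attach_step_def split: if_splits)
  qed
  show ?thesis using *[of b b'] *[of b' b] assms by (metis linorder_neqE_nat)
qed

text \<open>Among the infinitely many candidates for a fixed element, here 0, at most one stays
  attached; all others are bases.\<close>

lemma infinite_bases: "infinite {b. lim_att b = b}"
proof
  assume "finite {b. lim_att b = b}"
  moreover have "finite {b. p b = 0 \<and> lim_att b \<noteq> b}"
  proof (cases "\<exists>b. p b = 0 \<and> lim_att b \<noteq> b")
    case True
    then obtain b where "p b = 0" "lim_att b \<noteq> b" by blast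
    then have "c = b" if "p c = 0" "lim_att c \<noteq> c" for c
      using attached_unique[of c b] that by simp
    then have "{b. p b = 0 \<and> lim_att b \<noteq> b} \<subseteq> {b}" by auto
    then show ?thesis by (rule finite_subset) simp
  next
    case False
    then have "{b. p b = 0 \<and> lim_att b \<noteq> b} = {}" by blast
    then show ?thesis by (simp only: finite.emptyI)
  qed
  ultimately have "finite ({b. lim_att b = b} \<union> {b. p b = 0 \<and> lim_att b \<noteq> b})" by simp
  then have "finite {b. p b = 0}" by (rule finite_subset[rotated]) auto
  then show False using infinite_fibre by blast
qed

lemma bij_betw_rank: "bij_betw (rank lim_att) {b. lim_att b = b} UNIV"
  using bij_betw_card_below[OF infinite_bases] unfolding rank_def[abs_def] mem_Collect_eq .

lemma rank_inj_bases:
  assumes "d a = a" "d a' = a'" "rank d a = rank d a'"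
  shows "a = a'"
proof -
  have *: "rank d i < rank d j" if "d i = i" "i < j" for i j
    unfolding rank_def using that by (rule card_below_strict_mono)
  show ?thesis using *[of a a'] *[of a' a] assms by (cases a a' rule: linorder_cases) auto
qed

lemma attached_exists:
  assumes gx: "g x = Suc i"
  shows "\<exists>b. p b = x \<and> lim_att b \<noteq> b"
proof (rule ccontr)
  assume none: "\<not> ?thesis"
  obtain a where a: "lim_att a = a" "rank lim_att a = i"
    using bij_betw_rank by (metis (mono_tags, lifting) UNIV_I bij_betw_imp_surj_on imageE mem_Collect_eq)
  \<comment> \<open>From some stage on, the \<open>i\<close>-th base is settled as \<open>a\<close>
    and the label of \<open>x\<close> is correct.\<close>
  have "\<forall>\<^sub>F s in sequentially. att s a = a \<and> rank (att s) a = i \<and> G s x = Suc i \<and> a < s"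
    using att_limit[of a] rank_limit[of a] G_limit[of x] eventually_gt_at_top[of a]
    by eventually_elim (use a gx in auto)
  then obtain s0 where s0: "\<And>s. s0 \<le> s \<Longrightarrow> att s a = a \<and> rank (att s) a = i \<and> G s x = Suc i \<and> a < s"
    unfolding eventually_sequentially by blast
  \<comment> \<open>A candidate for \<open>x\<close> attached after \<open>s0\<close> could only be
    attached to \<open>a\<close>; this attachment would remain valid for ever, against the
    assumption.\<close>
  have free: "att (Suc t) b = b" if "s0 \<le> t" "p b = x" for t b
  proof (rule ccontr)
    assume neq: "att (Suc t) b \<noteq> b"
    have "valid p (G t) (att t) b (att (Suc t) b)" using neq by (rule att_Suc_valid)
    then have b: "att (Suc t) b = a" "a < b"
      using s0[OF that(1)] that(2) rank_inj_bases[of "att t"] by (auto simp: valid_def)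
    have "b < Suc t" using neq by (rule att_neq_imp_less)
    have stays: "att t' b = a" if "Suc t \<le> t'" for t'
      using that
    proof (induction t' rule: dec_induct)
      case (step t')
      then have "valid p (G t') (att t') b a"
        using s0[of t'] \<open>s0 \<le> t\<close> \<open>p b = x\<close> b by (auto simp: valid_def)
      then show ?case using step \<open>b < Suc t\<close> by (simp add: attach_step_def)
    qed (rule b)
    have "\<forall>\<^sub>F s in sequentially. lim_att b = a"
      using att_limit[of b] eventually_ge_at_top[of "Suc t"] by eventually_elim (use stays in simp)
    then show False using none \<open>p b = x\<close> b by auto
  qed
  \<comment> \<open>A candidate placed after \<open>Suc s0\<close> meets no attached copy of
    \<open>x\<close>, while \<open>a < s\<close> is valid for it; so it does get attached, which
    contradicts \<open>free\<close>.\<close>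
  obtain s where s: "p s = x" "Suc s0 < s"
    using infinite_fibre[of x] by (auto simp: infinite_nat_iff_unbounded)
  then obtain s' where s': "s = Suc s'" "s0 \<le> s'" by (cases s) auto
  have "valid p (G s) (att s) s a" using s0[of s] s by (auto simp: valid_def)
  moreover have "\<not> (\<exists>i<s. p i = p s \<and> att s i \<noteq> i)" using free s s' by auto
  ultimately have "att (Suc s) s \<le> a"
    by (auto simp: attach_step_def intro: Least_le)
  then show False using free[of s s] s s0[of s] by auto
qed

end

section \<open>Minima and indices of the classes\<close>

definition mins :: "nat rel \<Rightarrow> nat set" where
  "mins R = {m. \<forall>y<m. (y, m) \<notin> R}"

text \<open>For an equivalence relation this counts the minima below the least element of the class
  of \<open>x\<close>. The form consults only pairs of numbers up to \<open>x\<close>, by bounded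
  quantifiers, so it can be computed from a guess and converges with the guesses.\<close>

definition class_index :: "nat rel \<Rightarrow> nat \<Rightarrow> nat" where
  "class_index R x = card {m. m < x \<and> m \<in> mins R \<and> (\<forall>y<Suc m. (y, x) \<notin> R)}"

definition label :: "nat rel \<Rightarrow> nat \<Rightarrow> nat" where
  "label R x = (if x \<in> mins R then 0 else Suc (class_index R x))"

lemma class_index_eq:
  assumes "equiv UNIV R"
  defines "c \<equiv> \<lambda>x. LEAST y. (y, x) \<in> R"
  shows "class_index R x = card {m. m < c x \<and> m \<in> mins R}" and "c x \<in> mins R"
    and "(c x, x) \<in> R" and "x \<in> mins R \<Longrightarrow> c x = x"
proof -
  have refl: "(x, x) \<in> R" for x using assms(1) by (auto simp: equiv_def refl_on_def)
  show cR: "(c x, x) \<in> R" unfolding c_def by (rule LeastI[of _ x]) (rule refl)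
  have "c x \<le> x" unfolding c_def by (rule Least_le) (rule refl)
  have least: "(y, x) \<notin> R" if "y < c x" for y
    using that unfolding c_def by (rule not_less_Least)
  have below: "(\<forall>y<Suc m. (y, x) \<notin> R) \<longleftrightarrow> m < c x" for m
  proof
    assume "\<forall>y<Suc m. (y, x) \<notin> R"
    then have "\<not> c x < Suc m" using cR by auto
    then show "m < c x" by simp
  next
    assume "m < c x"
    then show "\<forall>y<Suc m. (y, x) \<notin> R" using least by simp
  qed
  show "class_index R x = card {m. m < c x \<and> m \<in> mins R}"
    unfolding class_index_def below using \<open>c x \<le> x\<close> by (rule_tac arg_cong[of _ _ card]) auto
  show "c x \<in> mins R"
  proof -
    have "(y, c x) \<notin> R" if "y < c x" for y
    proof
      assume "(y, c x) \<in> R"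
      then have "(y, x) \<in> R" using cR equivE[OF assms(1)] by (metis transD)
      then show False using least[OF that] by simp
    qed
    then show ?thesis by (simp add: mins_def)
  qed
  show "x \<in> mins R \<Longrightarrow> c x = x"
    using cR \<open>c x \<le> x\<close> le_neq_implies_less unfolding mins_def by blast
qed

text \<open>Each class is the class of its least element, so finitely many minima would give
  finitely many classes.\<close>

lemma infinite_mins:
  assumes "equiv UNIV R" "infinite (UNIV // R)"
  shows "infinite (mins R)"
proof
  assume "finite (mins R)"
  moreover have "UNIV // R \<subseteq> (\<lambda>m. R `` {m}) ` mins R"
  proof
    fix X assume "X \<in> UNIV // R"
    then obtain x where "X = R `` {x}" by (auto simp: quotient_def)
    then show "X \<in> (\<lambda>m. R `` {m}) ` mins R"
      using class_index_eq(2,3)[OF assms(1), of x] equiv_class_eq[OF assms(1)] by (intro image_eqI) auto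
  qed
  ultimately show False using assms(2) finite_surj by metis
qed

lemma class_index_iff:
  assumes "equiv UNIV R" "infinite (UNIV // R)"
  shows "class_index R x = class_index R y \<longleftrightarrow> (x, y) \<in> R"
proof -
  let ?c = "\<lambda>x. LEAST y. (y, x) \<in> R"
  note c = class_index_eq[OF assms(1)]
  have "class_index R x = class_index R y \<longleftrightarrow> ?c x = ?c y"
    using inj_on_eq_iff[OF bij_betw_imp_inj_on[OF bij_betw_card_below[OF infinite_mins[OF assms]]]
        c(2)[of x] c(2)[of y]] c(1)[of x] c(1)[of y] by argo
  also have "\<dots> \<longleftrightarrow> (x, y) \<in> R"
  proof
    show "?c x = ?c y \<Longrightarrow> (x, y) \<in> R"
      using c(3)[of x] c(3)[of y] assms(1) by (metis equivE symD transD)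
    assume "(x, y) \<in> R"
    then have "(z, x) \<in> R \<longleftrightarrow> (z, y) \<in> R" for z
      using assms(1) by (metis equivE symD transD)
    then show "?c x = ?c y" by simp
  qed
  finally show ?thesis .
qed

lemma (in limit_labelling) isomorphic_lim_att:
  assumes R: "equiv UNIV R" "infinite (UNIV // R)" and g: "\<And>x. g x = label R x"
  shows "isomorphic {(x, y). lim_att x = lim_att y} R"
proof -
  let ?B = "{b. lim_att b = b}"
  have bijM: "bij_betw (class_index R) (mins R) UNIV"
    using bij_betw_card_below[OF infinite_mins[OF R]] class_index_eq(1,4)[OF R(1)]
    by (simp cong: bij_betw_cong)
  \<comment> \<open>The \<open>i\<close>-th base goes to the \<open>i\<close>-th minimum and an
    attached element to the element it copies. Minima and non-minima are thus hit separately; for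
    the latter, injectivity is \<open>attached_unique\<close> and surjectivity is
    \<open>attached_exists\<close>.\<close>
  define F where "F b = (if lim_att b = b then inv_into (mins R) (class_index R) (rank lim_att b) else p b)" for b
  have base: "F b \<in> mins R \<and> class_index R (F b) = rank lim_att b" if "lim_att b = b" for b
    using bijM that unfolding F_def
    by (auto simp: bij_betw_def f_inv_into_f inv_into_into)
  have attached: "F b = p b \<and> F b \<notin> mins R \<and> class_index R (F b) = rank lim_att (lim_att b)"
    if "lim_att b \<noteq> b" for b
    using lim_att_label[OF that] g[of "p b"] that
    by (auto simp: F_def label_def split: if_splits)
  have index: "class_index R (F b) = rank lim_att (lim_att b)" for b
    using base attached by metis
  have rank_inj: "rank lim_att a = rank lim_att a' \<longleftrightarrow> a = a'"
    if "lim_att a = a" "lim_att a' = a'" for a a'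
    using that rank_inj_bases by blast
  have "inj F"
  proof (rule injI)
    fix b b' assume eq: "F b = F b'"
    show "b = b'"
    proof (cases "F b \<in> mins R")
      case True
      then have "lim_att b = b" "lim_att b' = b'" using attached eq by metis+
      then show ?thesis using base eq rank_inj by metis
    next
      case False
      then have "lim_att b \<noteq> b" "lim_att b' \<noteq> b'" using base eq by metis+
      then show ?thesis using attached attached_unique eq by metis
    qed
  qed
  moreover have "x \<in> range F" for x
  proof (cases "x \<in> mins R")
    case True
    obtain b where b: "lim_att b = b" "rank lim_att b = class_index R x"
      using bij_betw_rank by (metis (mono_tags, lifting) UNIV_I bij_betw_imp_surj_on imageE mem_Collect_eq)
    then have "F b = x" using base bijM True by (metis bij_betw_def inj_onD)
    then show ?thesis by blast
  next
    case False
    then obtain b where "p b = x" "lim_att b \<noteq> b"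
      using attached_exists[of x "class_index R x"] g by (auto simp: label_def)
    then show ?thesis using attached by (metis rangeI)
  qed
  ultimately have "bij F" by (auto simp: bij_def)
  moreover have "lim_att x = lim_att y \<longleftrightarrow> (F x, F y) \<in> R" for x y
    using class_index_iff[OF R] index rank_inj[OF lim_att_idem lim_att_idem] by metis
  ultimately show ?thesis unfolding isomorphic_def by auto
qed

subsection \<open>Computability of the construction\<close>

lemma decidable_comp3:
  "decidable 3 (\<lambda>e. f (e ! 0) (e ! 1) (e ! 2)) \<Longrightarrow> computable n a \<Longrightarrow> computable n b \<Longrightarrow> computable n c \<Longrightarrow>
    decidable n (\<lambda>e. f (a e) (b e) (c e))"
  unfolding decidable_def using computable_comp3[of "\<lambda>x y z. of_bool (f x y z)"] by simp

lemma decidable_env4: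
  assumes "decidable 4 f" "computable n a" "computable n b" "computable n c" "computable n d"
  shows "decidable n (\<lambda>e. f [a e, b e, c e, d e])"
  using computable_compose[of "[a, b, c, d]" "\<lambda>e. of_bool (f e)" n] assms
  unfolding decidable_def by (auto simp: eval_nat_numeral)

text \<open>Division by \<open>K\<close> drops the digit \<open>d 0\<close> and shifts the others
  down, hence the induction on \<open>i\<close> with \<open>n\<close> and \<open>d\<close>
  arbitrary.\<close>

lemma sum_digits:
  fixes K :: nat
  assumes "\<And>b. d b < K"
  shows "(\<Sum>b<n. d b * K ^ b) div K ^ i mod K = (if i < n then d i else 0)"
  using assms
proof (induction i arbitrary: n d)
  case 0
  then show ?case
    by (cases n) (auto simp: sum.lessThan_Suc_shift mult.left_commute simp flip: sum_distrib_left
        simp del: sum.lessThan_Suc)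
next
  case (Suc i)
  have "0 < K" using Suc.prems[of 0] by simp
  show ?case
  proof (cases n)
    case (Suc m)
    have "(\<Sum>b<n. d b * K ^ b) = d 0 + K * (\<Sum>b<m. d (Suc b) * K ^ b)"
      unfolding Suc by (simp add: sum.lessThan_Suc_shift sum_distrib_left mult.left_commute
          del: sum.lessThan_Suc)
    then have "(\<Sum>b<n. d b * K ^ b) div K = (\<Sum>b<m. d (Suc b) * K ^ b)"
      using Suc.prems[of 0] \<open>0 < K\<close> by simp
    then show ?thesis
      using Suc.IH[of "\<lambda>b. d (Suc b)" m] Suc.prems Suc by (simp add: div_mult2_eq)
  qed simp
qed

text \<open>Stage \<open>s\<close> reads only entries below \<open>s\<close>, so it may run on a
  decoded table that is correct just there.\<close>

lemma attach_step_cong: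
  assumes "\<And>i. i < s \<Longrightarrow> d i = d' i" "b \<le> s"
  shows "attach_step p h d s b = attach_step p h d' s b"
proof -
  have rank: "rank d a = rank d' a" if "a \<le> s" for a
    unfolding rank_def using assms(1) that by (intro arg_cong[of _ _ card]) auto
  have valid: "valid p h d b a = valid p h d' b a" for a
    unfolding valid_def using assms rank[of a] by (cases "a < b") auto
  have "(\<exists>i<b. p i = p b \<and> d i \<noteq> i) = (\<exists>i<b. p i = p b \<and> d' i \<noteq> i)"
    using assms by (metis less_le_trans)
  then show ?thesis unfolding attach_step_def valid using assms(1) by simp
qed

lemma attach_le: "attach p G s b \<le> b"
proof (induction s arbitrary: b)
  case (Suc s)
  have "(LEAST a. a = b \<or> valid p (G s) (attach p G s) b a) \<le> b"
    by (rule Least_le) simp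
  then show ?case using Suc.IH[of b] by (auto simp: attach_step_def)
qed simp

text \<open>
  A whole state with entries below \<open>K\<close> is coded by one number in base \<open>K\<close>, so that the stage
  recursion becomes a primitive recursion with the parameter \<open>K\<close>.
\<close>

definition attach_table :: "(nat \<Rightarrow> nat) \<Rightarrow> (nat \<Rightarrow> nat \<Rightarrow> nat) \<Rightarrow> nat \<Rightarrow> nat \<Rightarrow> nat" where
  "attach_table p G K s =
    rec_nat 0 (\<lambda>t T. \<Sum>b<Suc t. attach_step p (G t) (\<lambda>i. T div K ^ i mod K) t b * K ^ b) s"

lemma attach_table_eq:
  "s \<le> K \<Longrightarrow> attach_table p G K s = (\<Sum>b<s. attach p G s b * K ^ b)"
proof (induction s)
  case (Suc s)
  let ?T = "attach_table p G K s"
  \<comment> \<open>\<open>sum_digits\<close> wants every digit below \<open>K\<close>. Truncation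
    at \<open>K - 1\<close> ensures this and changes nothing for \<open>b < s\<close>, as
    \<open>attach p G s b \<le> b\<close>.\<close>
  have "?T = (\<Sum>b<s. min (attach p G s b) (K - 1) * K ^ b)"
    unfolding Suc.IH[OF Suc_leD[OF Suc.prems]]
    by (intro sum.cong refl) (use Suc.prems order_trans[OF attach_le] in \<open>fastforce simp: min_def\<close>)
  then have digit: "?T div K ^ i mod K = attach p G s i" if "i < s" for i
    using sum_digits[of "\<lambda>b. min (attach p G s b) (K - 1)" K s i] that Suc.prems attach_le[of p G s i]
    by simp
  have "attach_table p G K (Suc s) =
      (\<Sum>b<Suc s. attach_step p (G s) (\<lambda>i. ?T div K ^ i mod K) s b * K ^ b)"
    by (simp add: attach_table_def)
  also have "\<dots> = (\<Sum>b<Suc s. attach p G (Suc s) b * K ^ b)"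
  proof (intro sum.cong refl)
    fix b assume "b \<in> {..<Suc s}"
    then show "attach_step p (G s) (\<lambda>i. ?T div K ^ i mod K) s b * K ^ b = attach p G (Suc s) b * K ^ b"
      using attach_step_cong[of s "\<lambda>i. ?T div K ^ i mod K" "attach p G s" b] digit by simp
  qed
  finally show ?case .
qed (simp add: attach_table_def)

lemma attach_eq_digit:
  "attach p G s b = (if b < s then attach_table p G (Suc s) s div Suc s ^ b mod Suc s else b)"
proof (cases "b < s")
  case True
  have "attach_table p G (Suc s) s = (\<Sum>b<s. min (attach p G s b) s * Suc s ^ b)"
    unfolding attach_table_eq[OF le_SucI[OF order_refl]]
    by (intro sum.cong refl) (use order_trans[OF attach_le] in \<open>fastforce simp: min_def\<close>)
  then show ?thesis
    using sum_digits[of "\<lambda>b. min (attach p G s b) s" "Suc s" s b] True attach_le[of p G s b]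
    by (simp add: less_Suc_eq_le)
next
  case False
  then show ?thesis by (cases s) auto
qed

lemma computable_attach:
  assumes p: "computable 1 (\<lambda>e. p (e ! 0))" and G: "computable 2 (\<lambda>e. G (e ! 0) (e ! 1))"
    and s: "computable n s" and b: "computable n b"
  shows "computable n (\<lambda>e. attach p G (s e) (b e))"
proof -
  have "computable 2 (\<lambda>e. attach_table p G (e ! 0) (e ! 1))"
    unfolding attach_table_def attach_step_def valid_def rank_def numeral_2_eq_2
    by (intro computable_primrec computable_intros computable_comp1[OF p] computable_comp2[OF G]; simp)
  note table = computable_comp2[OF this]
  show ?thesis unfolding attach_eq_digit
    by (intro computable_intros table s b)
qed

text \<open>The count is the integer square root of \<open>b\<close>, so this is the distance from
  \<open>b\<close> down to the nearest square.\<close>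

definition sq_rem :: "nat \<Rightarrow> nat" where
  "sq_rem b = b - card {i. i < b \<and> Suc i * Suc i \<le> b} ^ 2"

lemma computable_sq_rem: "computable 1 (\<lambda>e. sq_rem (e ! 0))"
  unfolding sq_rem_def One_nat_def by (intro computable_intros; simp)

lemma infinite_sq_rem: "infinite {b. sq_rem b = x}"
  unfolding infinite_nat_iff_unbounded
proof
  fix m
  \<comment> \<open>Since \<open>k\<close> exceeds \<open>x\<close>, the number
    \<open>k * k + x\<close> stays below the next square; since \<open>k\<close> exceeds
    \<open>m\<close>, it lies beyond \<open>m\<close>.\<close>
  define k where "k = m + x + 1"
  have "i < k * k + x \<and> Suc i * Suc i \<le> k * k + x \<longleftrightarrow> i < k" for i
  proof
    assume "i < k * k + x \<and> Suc i * Suc i \<le> k * k + x"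
    moreover have "k * k + x < Suc k * Suc k" by (simp add: k_def)
    ultimately have "Suc i * Suc i < Suc k * Suc k" by linarith
    then have "Suc i < Suc k" by (metis mult_le_mono not_less)
    then show "i < k" by simp
  next
    assume "i < k"
    then have "Suc i * Suc i \<le> k * k" by (intro mult_le_mono) auto
    moreover have "i < Suc i * Suc i" by simp
    ultimately show "i < k * k + x \<and> Suc i * Suc i \<le> k * k + x" by linarith
  qed
  then have "{i. i < k * k + x \<and> Suc i * Suc i \<le> k * k + x} = {..<k}" by blast
  then have "sq_rem (k * k + x) = x" unfolding sq_rem_def by (simp add: power2_eq_square)
  moreover have "m < k * k + x" by (simp add: k_def)
  ultimately show "\<exists>b>m. b \<in> {b. sq_rem b = x}" by blast
qed

subsection \<open>The low levels of the arithmetical hierarchy\<close>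

lemma computable_rels_iff:
  "C \<in> computable_rels k \<longleftrightarrow> C \<subseteq> {e. length e = k} \<and> decidable k (\<lambda>e. e \<in> C)"
  unfolding computable_rels_def decidable_def computable_def by (auto simp: of_bool_def)

lemma decidable_imp_computable_rels: "decidable k P \<Longrightarrow> {e. length e = k \<and> P e} \<in> computable_rels k"
  unfolding computable_rels_iff by (auto elim!: decidable_cong)

lemma structs_Pi0_1I:
  assumes "decidable 3 (\<lambda>e. P (e ! 0) (e ! 1) (e ! 2))"
    and "\<And>x y. (x, y) \<in> S \<longleftrightarrow> (\<forall>s. P s x y)"
  shows "S \<in> structs (Pi0 1)"
proof -
  let ?C = "{e. length e = 3 \<and> P (e ! 0) (e ! 1) (e ! 2)}"
  have "?C \<in> Sigma0 0 (Suc 2)" using decidable_imp_computable_rels[OF assms(1)] by simp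
  moreover have "{[x, y] | x y. (x, y) \<in> S} = {xs. length xs = 2 \<and> (\<forall>y. y # xs \<in> ?C)}"
    by (auto simp: assms(2) length_Suc_conv numeral_2_eq_2 numeral_3_eq_3)
  ultimately show ?thesis unfolding structs_def One_nat_def Pi0.simps by blast
qed

lemma Pi0_1_subset_Delta0_2: "Pi0 1 2 \<subseteq> Delta0 2 2"
proof
  fix A assume "A \<in> Pi0 1 2"
  then obtain C where C: "C \<in> computable_rels 3" and A: "A = {xs. length xs = 2 \<and> (\<forall>y. y # xs \<in> C)}"
    by (auto simp: numeral_2_eq_2 numeral_3_eq_3)
  have len: "\<And>e. e \<in> C \<Longrightarrow> length e = 3" and decidable: "decidable 3 (\<lambda>e. e \<in> C)"
    using C unfolding computable_rels_iff by auto
  have comp3: "decidable n (\<lambda>e. [a e, b e, c e] \<in> C)" if "computable n a" "computable n b" "computable n c" for n a b c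
    using computable_compose[of "[a, b, c]" "\<lambda>e. of_bool (e \<in> C)" n] decidable that
    unfolding decidable_def by (auto simp: eval_nat_numeral)
  \<comment> \<open>Dummy quantifiers: entry 0 belongs to the inner quantifier and entry 1 to the
    outer one. \<open>?D\<close> ignores the outer, existential variable, \<open>?E\<close> the
    inner one.\<close>
  let ?D = "{e. length e = 4 \<and> [e ! 0, e ! 2, e ! 3] \<in> C}"
  let ?E = "{e. length e = 4 \<and> [e ! 1, e ! 2, e ! 3] \<in> C}"
  have "?D \<in> computable_rels 4" "?E \<in> computable_rels 4"
    by (intro decidable_imp_computable_rels comp3 computable_nth; simp)+
  then have D: "?D \<in> Sigma0 0 (Suc 3)" and E: "?E \<in> Pi0 0 (Suc 3)" by simp_all
  have "{xs. length xs = 3 \<and> (\<forall>z. z # xs \<in> ?D)} \<in> Pi0 (Suc 0) (Suc 2)"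
    unfolding Pi0.simps using D by (auto intro!: exI[of _ ?D])
  moreover have "A = {xs. length xs = 2 \<and> (\<exists>y. y # xs \<in> {xs. length xs = 3 \<and> (\<forall>z. z # xs \<in> ?D)})}"
    unfolding A by (auto simp: length_Suc_conv eval_nat_numeral)
  ultimately have "A \<in> Sigma0 (Suc (Suc 0)) 2"
    unfolding Sigma0.simps(2)[of "Suc 0"] by blast
  moreover have "{xs. length xs = 3 \<and> (\<exists>z. z # xs \<in> ?E)} \<in> Sigma0 (Suc 0) (Suc 2)"
    unfolding Sigma0.simps using E by (auto intro!: exI[of _ ?E])
  moreover have "A = {xs. length xs = 2 \<and> (\<forall>y. y # xs \<in> {xs. length xs = 3 \<and> (\<exists>z. z # xs \<in> ?E)})}"
    unfolding A by (auto simp: length_Suc_conv eval_nat_numeral)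
  ultimately have "A \<in> Sigma0 (Suc (Suc 0)) 2 \<and> A \<in> Pi0 (Suc (Suc 0)) 2"
    unfolding Pi0.simps(2)[of "Suc 0"] by blast
  then show "A \<in> Delta0 2 2" by (simp add: Delta0_def numeral_2_eq_2 del: Sigma0.simps Pi0.simps)
qed

lemma structs_Delta0_2E:
  assumes "R \<in> structs (Delta0 2)"
  obtains P Q where "decidable 4 P" "decidable 4 Q"
    "\<And>x y. (x, y) \<in> R \<longleftrightarrow> (\<exists>u. \<forall>v. P [v, u, x, y])"
    "\<And>x y. (x, y) \<in> R \<longleftrightarrow> (\<forall>u. \<exists>v. Q [v, u, x, y])"
proof -
  define A where "A = {[x, y] | x y. (x, y) \<in> R}"
  have *: "A \<in> Sigma0 (Suc (Suc 0)) 2" "A \<in> Pi0 (Suc (Suc 0)) 2"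
    using assms by (simp_all add: A_def structs_def Delta0_def numeral_2_eq_2 del: Sigma0.simps Pi0.simps)
  obtain C where C: "C \<in> computable_rels 4"
    "A = {xs. length xs = 2 \<and> (\<exists>y. y # xs \<in> {xs. length xs = 3 \<and> (\<forall>y. y # xs \<in> C)})}"
    using *(1) by (auto simp: eval_nat_numeral)
  obtain D where D: "D \<in> computable_rels 4"
    "A = {xs. length xs = 2 \<and> (\<forall>y. y # xs \<in> {xs. length xs = 3 \<and> (\<exists>y. y # xs \<in> D)})}"
    using *(2) by (auto simp: eval_nat_numeral)
  have A: "(x, y) \<in> R \<longleftrightarrow> [x, y] \<in> A" for x y by (simp add: A_def)
  show thesis
  proof (rule that[of "\<lambda>e. e \<in> C" "\<lambda>e. e \<in> D"])
    show "decidable 4 (\<lambda>e. e \<in> C)" "decidable 4 (\<lambda>e. e \<in> D)" using C D by (auto simp: computable_rels_iff)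
    show "(x, y) \<in> R \<longleftrightarrow> (\<exists>u. \<forall>v. [v, u, x, y] \<in> C)" for x y unfolding A C(2) by simp
    show "(x, y) \<in> R \<longleftrightarrow> (\<forall>u. \<exists>v. [v, u, x, y] \<in> D)" for x y unfolding A D(2) by simp
  qed
qed

text \<open>
  The guess at stage \<open>s\<close> is positive when some \<open>u\<close> looks like a witness for the \<open>\<Sigma>\<^sub>2\<close> form while
  no \<open>w \<le> u\<close> looks like a counterexample to the \<open>\<Pi>\<^sub>2\<close> form. If the \<open>\<Pi>\<^sub>2\<close> form fails at \<open>u\<^sub>0\<close>, only
  the finitely many \<open>u < u\<^sub>0\<close> matter, and all of them are refuted eventually.
\<close>

lemma Delta0_2_limit:
  assumes "R \<in> structs (Delta0 2)"
  obtains r where "decidable 3 (\<lambda>e. r (e ! 0) (e ! 1) (e ! 2))"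
    "\<And>x y. \<forall>\<^sub>F s in sequentially. r s x y \<longleftrightarrow> (x, y) \<in> R"
proof -
  obtain P Q where PQ: "decidable 4 P" "decidable 4 Q"
    and P: "\<And>x y. (x, y) \<in> R \<longleftrightarrow> (\<exists>u. \<forall>v. P [v, u, x, y])"
    and Q: "\<And>x y. (x, y) \<in> R \<longleftrightarrow> (\<forall>u. \<exists>v. Q [v, u, x, y])"
    using structs_Delta0_2E[OF assms] by blast
  define r where "r s x y \<longleftrightarrow> (\<exists>u<Suc s. (\<forall>v<s. P [v, u, x, y]) \<and> (\<forall>w<Suc u. \<exists>v<s. Q [v, w, x, y]))"
    for s x y
  have "decidable 3 (\<lambda>e. r (e ! 0) (e ! 1) (e ! 2))"
    unfolding r_def numeral_3_eq_3 by (intro computable_intros decidable_env4[OF PQ(1)] decidable_env4[OF PQ(2)]; simp)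
  moreover have "\<forall>\<^sub>F s in sequentially. r s x y \<longleftrightarrow> (x, y) \<in> R" for x y
  proof (cases "(x, y) \<in> R")
    case True
    then obtain u where u: "\<And>v. P [v, u, x, y]" using P by blast
    obtain f where f: "\<And>w. Q [f w, w, x, y]" using True Q by metis
    have "\<forall>\<^sub>F s in sequentially. \<forall>w\<in>{..<Suc u}. f w < s"
      by (rule eventually_ball_finite) (auto intro: eventually_gt_at_top)
    then show ?thesis using eventually_gt_at_top[of u]
    proof eventually_elim
      case (elim s)
      then have "r s x y" unfolding r_def using u f by (intro exI[of _ u]) auto
      then show ?case using True by simp
    qed
  next
    case False
    then obtain u where u: "\<And>v. \<not> Q [v, u, x, y]" using Q by blast
    obtain f where f: "\<And>w. \<not> P [f w, w, x, y]" using False P by metis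
    have "\<forall>\<^sub>F s in sequentially. \<forall>w\<in>{..<u}. f w < s"
      by (rule eventually_ball_finite) (auto intro: eventually_gt_at_top)
    then show ?thesis
    proof eventually_elim
      case (elim s)
      have "\<not> r s x y"
      proof
        assume "r s x y"
        then obtain w where w: "\<forall>v<s. P [v, w, x, y]" "\<forall>i<Suc w. \<exists>v<s. Q [v, i, x, y]"
          unfolding r_def by blast
        then have "w < u" using u by (metis not_less_eq)
        then show False using w(1) f elim by blast
      qed
      then show ?case using False by simp
    qed
  qed
  ultimately show thesis by (rule that)
qed

subsection \<open>Existence of the co-enumerable copy\<close>

lemma infinite_classes_case:
  assumes R: "equiv UNIV R" "infinite (UNIV // R)" and D: "R \<in> structs (Delta0 2)"
  shows "\<exists>S. S \<in> EQ \<inter> structs (Pi0 1) \<and> isomorphic S R"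
proof -
  obtain r where r: "decidable 3 (\<lambda>e. r (e ! 0) (e ! 1) (e ! 2))"
    and lim: "\<And>x y. \<forall>\<^sub>F s in sequentially. r s x y \<longleftrightarrow> (x, y) \<in> R"
    using Delta0_2_limit[OF D] by blast
  \<comment> \<open>The guessed relation need not be an equivalence; \<open>label\<close> makes
    sense for any relation.\<close>
  define G where "G s = label {(x, y). r s x y}" for s
  have G: "computable 2 (\<lambda>e. G (e ! 0) (e ! 1))"
    unfolding G_def label_def class_index_def mins_def mem_Collect_eq prod.case numeral_2_eq_2
    by (intro computable_intros decidable_comp3[OF r]; simp)
  interpret limit_labelling sq_rem G "label R"
  proof
    fix x
    show "infinite {b. sq_rem b = x}" by (rule infinite_sq_rem)
    \<comment> \<open>The label of \<open>x\<close> depends only on these finitely many pairs, whose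
      guesses all settle.\<close>
    have "\<forall>\<^sub>F s in sequentially. \<forall>z\<in>{..x} \<times> {..x}. r s (fst z) (snd z) \<longleftrightarrow> (fst z, snd z) \<in> R"
      by (rule eventually_ball_finite) (use lim in auto)
    then show "\<forall>\<^sub>F s in sequentially. G s x = label R x"
    proof eventually_elim
      case (elim s)
      then have e: "r s i j \<longleftrightarrow> (i, j) \<in> R" if "i \<le> x" "j \<le> x" for i j using that by fastforce
      have mins: "m \<in> mins {(x, y). r s x y} \<longleftrightarrow> m \<in> mins R" if "m \<le> x" for m
        unfolding mins_def using e that by auto
      have "class_index {(x, y). r s x y} x = class_index R x"
        unfolding class_index_def using e mins by (intro arg_cong[of _ _ card]) auto
      then show ?case unfolding G_def label_def using mins by simp
    qed
  qed
  let ?S = "{(x, y). lim_att x = lim_att y}"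
  have "?S \<in> structs (Pi0 1)"
  proof (rule structs_Pi0_1I)
    \<comment> \<open>The premises wait until both elements are present; earlier stages hold only
      default entries.\<close>
    show "decidable 3 (\<lambda>e. e ! 1 < e ! 0 \<and> e ! 2 < e ! 0 \<longrightarrow> att (e ! 0) (e ! 1) = att (e ! 0) (e ! 2))"
      by (intro computable_intros computable_attach[OF computable_sq_rem G]; simp)
  qed (use lim_att_eq_iff in auto)
  moreover have "?S \<in> EQ"
    unfolding EQ_def by (auto intro!: equivI refl_onI symI transI)
  ultimately show ?thesis using isomorphic_lim_att[OF R] by blast
qed

section \<open>Relations with finitely many classes\<close>

lemma isomorphic_kernels:
  assumes "\<And>i. \<exists>f. bij_betw f {x. \<psi> x = i} {x. \<phi> x = i}"
    and R: "\<And>x y. (x, y) \<in> R \<longleftrightarrow> \<phi> x = \<phi> y"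
  shows "isomorphic {(x, y). \<psi> x = \<psi> y} R"
proof -
  define f where "f i = (SOME f. bij_betw f {x. \<psi> x = i} {x. \<phi> x = i})" for i
  have f: "bij_betw (f i) {x. \<psi> x = i} {x. \<phi> x = i}" for i
    unfolding f_def using assms(1) by (rule someI_ex)
  define F where "F x = f (\<psi> x) x" for x
  have \<phi>F: "\<phi> (F x) = \<psi> x" for x
    using bij_betw_apply[OF f[of "\<psi> x"], of x] by (simp add: F_def)
  have "inj F"
  proof (rule injI)
    fix x y assume eq: "F x = F y"
    then have \<psi>: "\<psi> x = \<psi> y" using \<phi>F by metis
    show "x = y"
      by (rule inj_onD[OF bij_betw_imp_inj_on[OF f[of "\<psi> x"]]])
        (use eq[unfolded F_def \<psi>] \<psi> in simp_all)
  qed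
  moreover have "y \<in> range F" for y
  proof -
    have "y \<in> f (\<phi> y) ` {x. \<psi> x = \<phi> y}"
      unfolding bij_betw_imp_surj_on[OF f] by simp
    then obtain x where "\<psi> x = \<phi> y" "f (\<phi> y) x = y" by auto
    then have "y = F x" by (simp add: F_def)
    then show ?thesis by (rule range_eqI)
  qed
  then have "range F = UNIV" by blast
  ultimately have "bij F" by (rule bijI)
  then show ?thesis unfolding isomorphic_def using \<phi>F R by auto
qed

text \<open>A finite table is computable however its values are obtained, so noneffective choices
  may enter it.\<close>

lemma computable_finite_table: "computable 1 (\<lambda>e. if e ! 0 < u then f (e ! 0) else 0)"
proof (induction u)
  case 0
  show ?case by (simp add: computable_const)
next
  case (Suc u)
  have "computable 1 (\<lambda>e. if e ! 0 = u then f u else if e ! 0 < u then f (e ! 0) else 0)"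
    by (intro computable_if decidable_eq computable_const Suc.IH computable_nth) simp
  then show ?case by (rule computable_cong) auto
qed

text \<open>
  The infinite classes become residue classes modulo their number; the finite ones are listed in a
  finite table on an initial segment.
\<close>

lemma finite_classes_case:
  assumes R: "equiv UNIV R" "finite (UNIV // R)"
  shows "\<exists>S. S \<in> EQ \<inter> structs (Pi0 1) \<and> isomorphic S R"
proof -
  define \<phi> where "\<phi> x = (LEAST y. y \<in> R `` {x})" for x
  have \<phi>: "(x, y) \<in> R \<longleftrightarrow> \<phi> x = \<phi> y" for x y
  proof
    assume "\<phi> x = \<phi> y"
    moreover have "(x, \<phi> x) \<in> R" for x
      unfolding \<phi>_def using LeastI[of "\<lambda>y. y \<in> R `` {x}" x] R(1)
      by (auto simp: equiv_def refl_on_def)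
    ultimately show "(x, y) \<in> R" using equivE[OF R(1)] by (metis symD transD)
  qed (simp add: \<phi>_def equiv_class_eq[OF R(1)])
  have "range \<phi> \<subseteq> (\<lambda>X. LEAST y. y \<in> X) ` (UNIV // R)"
    unfolding \<phi>_def quotient_def by blast
  then have fin: "finite (range \<phi>)" using R(2) finite_surj by metis
  define I where "I = {i. infinite {x. \<phi> x = i}}"
  have "I \<subseteq> range \<phi>"
  proof
    fix i assume "i \<in> I"
    then have "{x. \<phi> x = i} \<noteq> {}" unfolding I_def using finite.emptyI by fastforce
    then show "i \<in> range \<phi>" by auto
  qed
  then have "finite I" using fin finite_subset by blast
  have "{x. \<phi> x \<notin> I} = (\<Union>i\<in>range \<phi> - I. {x. \<phi> x = i})" by auto
  then have finU: "finite {x. \<phi> x \<notin> I}" using fin by (auto simp: I_def)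
  \<comment> \<open>Finitely many finite classes cannot cover all natural numbers.\<close>
  have "I \<noteq> {}"
  proof
    assume "I = {}"
    then show False using finU by simp
  qed
  define u where "u = card {x. \<phi> x \<notin> I}"
  define k where "k = card I"
  have "0 < k" using \<open>finite I\<close> \<open>I \<noteq> {}\<close> by (simp add: k_def card_gt_0_iff)
  obtain h where h: "bij_betw h {0..<u} {x. \<phi> x \<notin> I}"
    unfolding u_def using ex_bij_betw_nat_finite[OF finU] by blast
  obtain c where c: "bij_betw c {0..<k} I"
    unfolding k_def using ex_bij_betw_nat_finite[OF \<open>finite I\<close>] by blast
  \<comment> \<open>Blocks carry the same names as under \<open>\<phi>\<close>: \<open>h\<close>
    lists the \<open>u\<close> elements of finite classes, \<open>c\<close> the \<open>k\<close>
    names of infinite ones.\<close>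
  define \<psi> where "\<psi> b = (if b < u then \<phi> (h b) else c (b mod k))" for b
  have hU: "\<phi> (h b) \<notin> I" if "b < u" for b using bij_betw_apply[OF h, of b] that by simp
  have cI: "c (b mod k) \<in> I" for b using bij_betw_apply[OF c, of "b mod k"] \<open>0 < k\<close> by simp
  have "\<exists>f. bij_betw f {x. \<psi> x = i} {x. \<phi> x = i}" for i
  proof (cases "i \<in> I")
    case True
    then obtain j where j: "j < k" "c j = i"
      using bij_betw_imp_surj_on[OF c] by (metis atLeastLessThan_iff imageE)
    have "infinite {x. \<psi> x = i}" unfolding infinite_nat_iff_unbounded
    proof
      fix m
      let ?b = "Suc (m + u) * k + j"
      have "Suc (m + u) \<le> Suc (m + u) * k" using \<open>0 < k\<close> by (cases k) auto
      then have "m + u < ?b" by (intro Suc_le_lessD trans_le_add1)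
      moreover have "?b mod k = j" using j(1) by (metis mod_less mod_mult_self3)
      ultimately show "\<exists>n>m. n \<in> {x. \<psi> x = i}"
        using j(2) \<open>m + u < ?b\<close> by (intro exI[of _ ?b]) (auto simp: \<psi>_def)
    qed
    moreover have "infinite {x. \<phi> x = i}" using True by (simp add: I_def)
    \<comment> \<open>Any two infinite sets of naturals are matched through their position
      functions.\<close>
    ultimately show ?thesis
      using bij_betw_card_below bij_betw_trans bij_betw_inv by meson
  next
    case False
    have "h ` {x. \<psi> x = i} = {x. \<phi> x = i}"
    proof
      show "h ` {x. \<psi> x = i} \<subseteq> {x. \<phi> x = i}"
      proof safe
        fix b assume "i = \<psi> b"
        then show "\<phi> (h b) = \<psi> b" using cI[of b] False by (cases "b < u") (auto simp: \<psi>_def)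
      qed
      show "{x. \<phi> x = i} \<subseteq> h ` {x. \<psi> x = i}"
      proof
        fix x assume x: "x \<in> {x. \<phi> x = i}"
        then have "x \<in> {x. \<phi> x \<notin> I}" using False by simp
        then obtain b where "b < u" "x = h b"
          using bij_betw_imp_surj_on[OF h] by (metis atLeastLessThan_iff imageE)
        then show "x \<in> h ` {x. \<psi> x = i}" using x by (auto simp: \<psi>_def)
      qed
    qed
    moreover have "{x. \<psi> x = i} \<subseteq> {0..<u}"
    proof
      fix b assume "b \<in> {x. \<psi> x = i}"
      then show "b \<in> {0..<u}" using cI[of b] False by (cases "b < u") (auto simp: \<psi>_def)
    qed
    ultimately show ?thesis using bij_betw_subset[OF h] by blast
  qed
  from isomorphic_kernels[OF this \<phi>] have "isomorphic {(x, y). \<psi> x = \<psi> y} R" .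
  moreover have "{(x, y). \<psi> x = \<psi> y} \<in> structs (Pi0 1)"
  proof (rule structs_Pi0_1I)
    let ?t = "\<lambda>b. if b < u then \<phi> (h b) else 0"
    let ?t' = "\<lambda>b. if b < k then c b else 0"
    have "computable 1 (\<lambda>e. if e ! 0 < u then ?t (e ! 0) else ?t' (e ! 0 mod k))"
      by (intro computable_if decidable_less computable_const computable_nth computable_mod computable_finite_table
          computable_comp1[of ?t, OF computable_finite_table] computable_comp1[of ?t', OF computable_finite_table]) simp_all
    then have \<psi>: "computable 1 (\<lambda>e. \<psi> (e ! 0))"
      by (rule computable_cong) (use \<open>0 < k\<close> in \<open>auto simp: \<psi>_def\<close>)
    show "decidable 3 (\<lambda>e. \<psi> (e ! 1) = \<psi> (e ! 2))"
      by (intro decidable_eq computable_comp1[OF \<psi>] computable_nth) simp_all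
  qed simp
  moreover have "{(x, y). \<psi> x = \<psi> y} \<in> EQ"
    unfolding EQ_def by (auto intro!: equivI refl_onI symI transI)
  ultimately show ?thesis by blast
qed

section \<open>Passage to isomorphism types\<close>

lemma isomorphic_sym:
  assumes "isomorphic R S" shows "isomorphic S R"
proof -
  obtain f where f: "bij f" "\<And>x y. (x, y) \<in> R \<longleftrightarrow> (f x, f y) \<in> S"
    using assms unfolding isomorphic_def by blast
  have "f (inv f x) = x" for x using f(1) by (simp add: bij_is_surj surj_f_inv_f)
  then show ?thesis
    unfolding isomorphic_def f(2) using bij_imp_bij_inv[OF f(1)] by (intro exI[of _ "inv f"]) simp
qed

lemma isomorphic_trans:
  assumes "isomorphic R S" "isomorphic S T"
  shows "isomorphic R T"
proof -
  obtain f g where "bij f" "\<forall>x y. (x, y) \<in> R \<longleftrightarrow> (f x, f y) \<in> S"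
    "bij g" "\<forall>x y. (x, y) \<in> S \<longleftrightarrow> (g x, g y) \<in> T"
    using assms unfolding isomorphic_def by blast
  then show ?thesis unfolding isomorphic_def by (intro exI[of _ "g \<circ> f"]) (simp add: bij_comp)
qed

lemma iso_type_eq: "isomorphic R S \<Longrightarrow> iso_type R = iso_type S"
  unfolding iso_type_def by (intro Collect_cong) (metis isomorphic_sym isomorphic_trans)

theorem theorem2p2:
  shows "IsoType EQ (Pi0 1) = IsoType EQ (Delta0 2) \<and>
    (\<forall>R \<in> EQ \<inter> structs (Delta0 2). \<exists>S \<in> EQ \<inter> structs (Pi0 1). isomorphic R S) \<and>
    EQ \<inter> structs (Pi0 1) \<subseteq> EQ \<inter> structs (Delta0 2)"
proof -
  have iso: "\<exists>S \<in> EQ \<inter> structs (Pi0 1). isomorphic R S" if "R \<in> EQ \<inter> structs (Delta0 2)" for R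
    using infinite_classes_case[of R] finite_classes_case[of R] isomorphic_sym that
    by (cases "finite (UNIV // R)") (auto simp: EQ_def)
  moreover have sub: "EQ \<inter> structs (Pi0 1) \<subseteq> EQ \<inter> structs (Delta0 2)"
    using Pi0_1_subset_Delta0_2 by (auto simp: structs_def)
  moreover have "IsoType EQ (Pi0 1) = IsoType EQ (Delta0 2)"
  proof
    show "IsoType EQ (Pi0 1) \<subseteq> IsoType EQ (Delta0 2)" unfolding IsoType_def using sub by (rule image_mono)
    show "IsoType EQ (Delta0 2) \<subseteq> IsoType EQ (Pi0 1)"
    proof
      fix X assume "X \<in> IsoType EQ (Delta0 2)"
      then obtain R where R: "R \<in> EQ \<inter> structs (Delta0 2)" "X = iso_type R"
        unfolding IsoType_def by blast
      then obtain S where "S \<in> EQ \<inter> structs (Pi0 1)" "isomorphic R S" using iso by blast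
      then show "X \<in> IsoType EQ (Pi0 1)" unfolding IsoType_def using R(2) iso_type_eq by blast
    qed
  qed
  ultimately show ?thesis by blast
qed

end
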